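(* Let $G=(V,E)$ be a graph and let $v\in V$. Then $$\gamma_{\rm esp}(G)-1\le \gamma_{\rm esp}(G-v)\le \gamma_{\rm esp}(G)+\deg_G(v)-1.$$
   Context: Graphs are finite, simple and undirected. For a graph $G=(V,E)$ and $S\subseteq V$, write $\overline{S}=V\setminus S$, and let $N(v)$ be the open neighbourhood of $v$. A set $S \subseteq V$ is an end super dominating set (ESD-set) of $G$ if for every $u\in\overline{S}$ there exists $v\in S$ with $N(v)\cap\overline{S}=\{u\}$, and moreover $\deg(u)\ge 2$ for every $u\in\overline{S}$. The end super domination number $\gamma_{\rm esp}(G)$ is the minimum cardinality of an ESD-set of $G$. $G-v$ denotes the graph obtained from $G$ by deleting the vertex $v$ and all edges incident with $v$; it need not be connected. *)

theory Defs
  imports "Graph_Theory.Digraph"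
begin

text \<open>
  A finite simple undirected graph is an instance of \<^locale>\<open>graph\<close>: a finite symmetric digraph
  without loops and parallel arcs. An undirected edge \<open>{u, v}\<close> is represented by the two arcs
  \<open>(u, v)\<close> and \<open>(v, u)\<close>, so the degree of a vertex is its \<^const>\<open>out_degree\<close>
  (see \<open>out_degree_eq_card_neighbourhood\<close> below). The vertex set may be empty.
\<close>

definition neighbourhood :: "('a, 'b) pre_digraph \<Rightarrow> 'a \<Rightarrow> 'a set" where
  "neighbourhood G v = {u. v \<rightarrow>\<^bsub>G\<^esub> u}"

definition end_super_dominating :: "('a, 'b) pre_digraph \<Rightarrow> 'a set \<Rightarrow> bool" where
  "end_super_dominating G S \<longleftrightarrow>
     S \<subseteq> verts G \<and>
     (\<forall>u \<in> verts G - S.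
        (\<exists>v \<in> S. neighbourhood G v \<inter> (verts G - S) = {u}) \<and> out_degree G u \<ge> 2)"

definition end_super_domination_number :: "('a, 'b) pre_digraph \<Rightarrow> nat" where
  "end_super_domination_number G = Min (card ` {S. end_super_dominating G S})"

lemma (in graph) out_degree_eq_card_neighbourhood:
  "out_degree G v = card (neighbourhood G v)"
proof -
  have img: "neighbourhood G v = head G ` out_arcs G v"
    by (auto simp: neighbourhood_def arcs_ends_conv out_arcs_def image_iff)
  have inj: "inj_on (head G) (out_arcs G v)"
    by (auto simp: inj_on_def out_arcs_def arc_to_ends_def intro!: no_multi_arcs)
  show ?thesis
    by (simp add: img card_image[OF inj] out_degree_def)
qed

text \<open>The minimum ranges over a finite nonempty set, so \<^const>\<open>Min\<close> is meaningful.\<close>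

lemma (in fin_digraph) end_super_dominating_sets:
  shows finite_end_super_dominating: "finite {S. end_super_dominating G S}"
    and end_super_dominating_verts: "end_super_dominating G (verts G)"
proof -
  have "{S. end_super_dominating G S} \<subseteq> Pow (verts G)"
    by (auto simp: end_super_dominating_def)
  then show "finite {S. end_super_dominating G S}"
    by (rule finite_subset) simp
  show "end_super_dominating G (verts G)"
    by (simp add: end_super_dominating_def)
qed

lemma (in graph) graph_del_vert: "graph (del_vert v)"
proof -
  interpret H: wf_digraph "del_vert v" by (rule wf_digraph_del_vert)
  have "symmetric (del_vert v)"
    using sym_arcs
    by (auto simp: symmetric_def sym_def arcs_ends_conv del_vert_simps image_iff)
  then show ?thesis
    by unfold_locales
      (auto simp: del_vert_simps arc_to_ends_def no_loops intro: no_multi_arcs)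
qed

end

theory Submission
  imports Defs
begin

text \<open>
  If \<open>S'\<close> is an ESD-set of \<open>G - v\<close>, then \<open>S' \<union> {v}\<close> is one of \<open>G\<close>. Conversely, if \<open>S\<close> is an
  ESD-set of \<open>G\<close>, then \<open>(S \<union> N(v)) - {v}\<close> is one of \<open>G - v\<close>: a vertex that remains outside is not
  adjacent to \<open>v\<close>, so it keeps its degree and its private dominator. The \<open>- 1\<close> in the size of this
  set comes from removing \<open>v\<close> if \<open>v \<in> S\<close>, and otherwise from the dominator of \<open>v\<close>, which lies in
  \<open>S \<inter> N(v)\<close>.
\<close>

lemma (in graph) neighbourhood_sym:
  "u \<in> neighbourhood G w \<longleftrightarrow> w \<in> neighbourhood G u"
  using sym_arcs by (auto simp: neighbourhood_def symmetric_def dest: symD)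

lemma (in graph) neighbourhood_subset_verts: "neighbourhood G w \<subseteq> verts G"
  by (auto simp: neighbourhood_def dest: adj_in_verts)

lemma (in graph) finite_neighbourhood: "finite (neighbourhood G w)"
  using neighbourhood_subset_verts by (rule finite_subset) simp

text \<open>For \<open>w = v\<close> the equation can fail: deleting \<open>v\<close> removes every
  arc at \<open>v\<close>, so the left side is then empty.\<close>

lemma (in graph) neighbourhood_del_vert:
  assumes "w \<noteq> v"
  shows "neighbourhood (del_vert v) w = neighbourhood G w - {v}"
  using assms by (auto simp: neighbourhood_def arcs_ends_conv del_vert_simps image_iff)

lemma (in fin_digraph) end_super_domination_number_le:
  assumes "end_super_dominating G S"
  shows "end_super_domination_number G \<le> card S"
  unfolding end_super_domination_number_def
  using assms finite_end_super_dominating by (intro Min_le) auto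

lemma (in fin_digraph) end_super_domination_number_attained:
  obtains S where "end_super_dominating G S" "card S = end_super_domination_number G"
proof -
  have "Min (card ` {S. end_super_dominating G S}) \<in> card ` {S. end_super_dominating G S}"
    using finite_end_super_dominating end_super_dominating_verts by (intro Min_in) auto
  then show thesis
    using that unfolding end_super_domination_number_def by auto
qed

text \<open>Both sets have the same complement, and \<open>v\<close> is not in it. So deleting
  \<open>v\<close> changes no intersection of a neighbourhood of a dominator with the complement,
  and restoring \<open>v\<close> can only raise degrees.\<close>

lemma (in graph) end_super_dominating_insert:
  assumes "v \<in> verts G" and S: "end_super_dominating (del_vert v) S"
  shows "end_super_dominating G (insert v S)"
  unfolding end_super_dominating_def
proof (intro conjI ballI)
  interpret H: graph "del_vert v" by (rule graph_del_vert)
  have sub: "S \<subseteq> verts G - {v}"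
    using S by (auto simp: end_super_dominating_def del_vert_simps)
  then show "insert v S \<subseteq> verts G"
    using assms(1) by auto
  fix u assume u: "u \<in> verts G - insert v S"
  then have "u \<in> verts (del_vert v) - S" by (simp add: del_vert_simps)
  then obtain w where w: "w \<in> S" "neighbourhood (del_vert v) w \<inter> (verts (del_vert v) - S) = {u}"
    and deg: "out_degree (del_vert v) u \<ge> 2"
    using S unfolding end_super_dominating_def by blast
  have "w \<noteq> v" using w(1) sub by auto
  then have "neighbourhood G w \<inter> (verts G - insert v S) = {u}"
    using w(2) by (auto simp: neighbourhood_del_vert del_vert_simps)
  then show "\<exists>w \<in> insert v S. neighbourhood G w \<inter> (verts G - insert v S) = {u}"
    using w(1) by blast
  have "neighbourhood (del_vert v) u \<subseteq> neighbourhood G u"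
    using u by (auto simp: neighbourhood_del_vert)
  then have "out_degree (del_vert v) u \<le> out_degree G u"
    by (simp add: out_degree_eq_card_neighbourhood H.out_degree_eq_card_neighbourhood
        card_mono finite_neighbourhood)
  then show "out_degree G u \<ge> 2" using deg by simp
qed

lemma (in graph) end_super_dominating_del_vert:
  assumes S: "end_super_dominating G S"
  shows "end_super_dominating (del_vert v) (S \<union> neighbourhood G v - {v})"
    (is "end_super_dominating _ ?S")
  unfolding end_super_dominating_def
proof (intro conjI ballI)
  interpret H: graph "del_vert v" by (rule graph_del_vert)
  show "?S \<subseteq> verts (del_vert v)"
    using S neighbourhood_subset_verts by (auto simp: end_super_dominating_def del_vert_simps)
  fix u assume "u \<in> verts (del_vert v) - ?S"
  then have u: "u \<in> verts G - S" "u \<noteq> v" "u \<notin> neighbourhood G v"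
    by (auto simp: del_vert_simps)
  then obtain w where w: "w \<in> S" "neighbourhood G w \<inter> (verts G - S) = {u}"
    and deg: "out_degree G u \<ge> 2"
    using S unfolding end_super_dominating_def by blast
  \<comment> \<open>The vertex \<open>u\<close> is a neighbour of \<open>w\<close> but not of
    \<open>v\<close>.\<close>
  have "w \<noteq> v" using w(2) u(3) by auto
  \<comment> \<open>The new complement lies inside the old one and still contains \<open>u\<close>,
    so the intersection stays \<open>{u}\<close>.\<close>
  then have "neighbourhood (del_vert v) w \<inter> (verts (del_vert v) - ?S) = {u}"
    using w(2) u by (auto simp: neighbourhood_del_vert del_vert_simps)
  then show "\<exists>w \<in> ?S. neighbourhood (del_vert v) w \<inter> (verts (del_vert v) - ?S) = {u}"
    using w(1) \<open>w \<noteq> v\<close> by blast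
  have "neighbourhood (del_vert v) u = neighbourhood G u"
    using u(2,3) neighbourhood_sym[of u v] by (simp add: neighbourhood_del_vert)
  then show "out_degree (del_vert v) u \<ge> 2"
    using deg by (simp add: out_degree_eq_card_neighbourhood H.out_degree_eq_card_neighbourhood)
qed

text \<open>The strict inequality encodes the \<open>- 1\<close> without truncated subtraction on
  naturals.\<close>

lemma (in graph) card_end_super_dominating_del_vert:
  assumes "v \<in> verts G" and S: "end_super_dominating G S"
  shows "card (S \<union> neighbourhood G v - {v}) < card S + out_degree G v"
proof -
  have fin: "finite S"
    using S unfolding end_super_dominating_def by (auto intro: finite_subset)
  \<comment> \<open>Inclusion-exclusion reduces the claim to gaining one unit: either deleting
    \<open>v\<close> shrinks the union, or the intersection is nonempty.\<close>
  have card: "card (S \<union> neighbourhood G v) + card (S \<inter> neighbourhood G v)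
      = card S + out_degree G v"
    using card_Un_Int[OF fin finite_neighbourhood]
    by (simp add: out_degree_eq_card_neighbourhood)
  show ?thesis
  proof (cases "v \<in> S")
    case True
    then have "card (S \<union> neighbourhood G v - {v}) < card (S \<union> neighbourhood G v)"
      using fin finite_neighbourhood by (intro card_Diff1_less) auto
    then show ?thesis using card by linarith
  next
    case False
    then obtain w where "w \<in> S" "neighbourhood G w \<inter> (verts G - S) = {v}"
      using S assms(1) unfolding end_super_dominating_def by blast
    then have "w \<in> S \<inter> neighbourhood G v"
      using neighbourhood_sym[of v w] by auto
    then have "card (S \<inter> neighbourhood G v) > 0"
      using fin by (auto simp: card_gt_0_iff)
    moreover have "card (S \<union> neighbourhood G v - {v}) \<le> card (S \<union> neighbourhood G v)"
      by (rule card_Diff1_le)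
    ultimately show ?thesis using card by linarith
  qed
qed

theorem proposition6p4:
  fixes G :: "('a, 'b) pre_digraph" and v :: 'a
  assumes "graph G" and "v \<in> verts G"
  shows "int (end_super_domination_number G) - 1
           \<le> int (end_super_domination_number (pre_digraph.del_vert G v)) \<and>
         int (end_super_domination_number (pre_digraph.del_vert G v))
           \<le> int (end_super_domination_number G) + int (out_degree G v) - 1"
proof -
  interpret graph G by (rule assms(1))
  interpret H: graph "del_vert v" by (rule graph_del_vert)
  obtain S where S: "end_super_dominating G S" "card S = end_super_domination_number G"
    by (rule end_super_domination_number_attained)
  obtain S' where S': "end_super_dominating (del_vert v) S'"
      "card S' = end_super_domination_number (del_vert v)"
    by (rule H.end_super_domination_number_attained)
  have "end_super_domination_number G \<le> card (insert v S')"
    using end_super_dominating_insert[OF assms(2) S'(1)] by (rule end_super_domination_number_le)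
  also have "\<dots> \<le> card S' + 1"
    \<comment> \<open>The bound \<open>card S' + 1\<close> is chosen so that its predecessor is
      \<open>card S'\<close>.\<close>
    using card_insert_le_m1[of "card S' + 1" S' v] by simp
  finally have lower: "end_super_domination_number G \<le> card S' + 1" .
  have "end_super_domination_number (del_vert v) \<le> card (S \<union> neighbourhood G v - {v})"
    using end_super_dominating_del_vert[OF S(1)] by (rule H.end_super_domination_number_le)
  also have "\<dots> < card S + out_degree G v"
    using assms(2) S(1) by (rule card_end_super_dominating_del_vert)
  \<comment> \<open>Over the integers, the strict inequality between naturals becomes the upper
    bound with \<open>- 1\<close>.\<close>
  finally show ?thesis using lower S(2) S'(2) by linarith
qed

end
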